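(* For every $p_0\in(0,1/2)$ there are constants $C=C(p_0)>0$ and $a_0=a_0(p_0)\in(0,1)$ such that for all $a\in(a_0,1)$, \[ \inf_{p\in[p_0,1-p_0]}\dim_\infty(\nu_a^p)\ \ge\ 1-C\,(1-a)\log\bigl(1/(1-a)\bigr). \]
   Context: For $a\in(0,1)$ and $p\in(0,1)$, the (biased) Bernoulli convolution $\nu_a^p$ is the distribution of the random sum $\sum_{n=1}^\infty \pm a^n$, where the signs are independent and identically distributed with $\mathbb{P}(+)=p$ and $\mathbb{P}(-)=1-p$. For a Borel probability measure $\mu$ on $\mathbb{R}$, the Frostman exponent ($L^\infty$-dimension) is \[ \dim_\infty(\mu)=\liminf_{r\downarrow 0}\frac{\log\sup_{x\in\operatorname{supp}(\mu)}\mu(B(x,r))}{\log r}, \] where $B(x,r)$ is the ball (interval) of center $x$ and radius $r$. *)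

theory Defs
  imports "HOL-Probability.Probability"
begin

text \<open>
  The index set of the product starts at \<open>0\<close>, so coordinate \<open>n\<close> carries the sign of
  \<open>a ^ (n + 1)\<close>; \<open>True\<close> stands for the sign \<open>+\<close>.
\<close>

definition sign_space :: "real \<Rightarrow> (nat \<Rightarrow> bool) measure" where
  "sign_space p = (\<Pi>\<^sub>M n\<in>UNIV. measure_pmf (bernoulli_pmf p))"

definition random_sum :: "real \<Rightarrow> (nat \<Rightarrow> bool) \<Rightarrow> real" where
  "random_sum a \<omega> = (\<Sum>n. (if \<omega> n then 1 else - 1) * a ^ Suc n)"

definition bernoulli_convolution :: "real \<Rightarrow> real \<Rightarrow> real measure" where
  "bernoulli_convolution a p = distr (sign_space p) borel (random_sum a)"

lemma measurable_random_sum [measurable]: "random_sum a \<in> borel_measurable (sign_space p)"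
proof -
  have "(\<lambda>\<omega>. if \<omega> n then 1 else - 1 :: real) \<in> borel_measurable (sign_space p)" for n
    unfolding sign_space_def by measurable
  then show ?thesis
    unfolding random_sum_def by measurable
qed

lemma prob_space_bernoulli_convolution: "prob_space (bernoulli_convolution a p)"
proof -
  have "prob_space (sign_space p)"
    unfolding sign_space_def by (intro prob_space_PiM prob_space_measure_pmf)
  then show ?thesis
    unfolding bernoulli_convolution_def
    by (rule prob_space.prob_space_distr) measurable
qed

definition msupport :: "'a::topological_space measure \<Rightarrow> 'a set" where
  "msupport \<mu> = {x. \<forall>U. open U \<and> x \<in> U \<longrightarrow> emeasure \<mu> U > 0}"

text \<open>
  For a Borel probability measure the supremum below lies in \<open>(0, 1]\<close>, so \<open>ln\<close> and the real
  supremum are used only where they are meaningful. The lower limit is taken in the extended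
  reals, because the quotient need not be bounded.
\<close>

definition frostman_exponent :: "real measure \<Rightarrow> ereal" where
  "frostman_exponent \<mu> =
     Liminf (at_right 0) (\<lambda>r. ereal (ln (SUP x\<in>msupport \<mu>. measure \<mu> (ball x r)) / ln r))"

end

theory Submission
  imports Defs
begin

text \<open>
  Write \<open>\<epsilon> = 1 - a\<close> and let \<open>\<nu>\<close> be the Bernoulli convolution. It is self-similar: \<open>\<nu>\<close> is the mixture,
  with weights \<open>p\<close> and \<open>1 - p\<close>, of its images under \<open>x \<mapsto> \<plusminus>a + a x\<close>. Everything below is drawn from
  this identity and from the fact that \<open>\<nu>\<close> lives on \<open>(-1/\<epsilon>, 1/\<epsilon>)\<close>.

  The first half is Fourier analysis. The characteristic function of \<open>\<nu>\<close> at \<open>t\<close> is a product of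
  two-point characteristic functions at the angles \<open>a ^ n * t\<close>. If \<open>\<bar>t\<bar> \<ge> 1\<close>, the angles decrease so
  slowly that about \<open>1/\<epsilon>\<close> of them lie in \<open>[1/2, 1]\<close>, and each of those factors is bounded away from
  \<open>1\<close>, uniformly for \<open>p\<close> in a compact subset of \<open>(0, 1)\<close>. Hence the characteristic function is at most
  \<open>\<rho> = exp (- c/\<epsilon>)\<close> for all \<open>\<bar>t\<bar> \<ge> 1\<close> (\<open>norm_char_decay\<close>). There is no decay as \<open>t \<rightarrow> \<infinity>\<close> in this
  bound, but it forces \<open>\<nu> (B(x, r)) \<le> 2 (r + \<rho>)\<close> (\<open>measure_ball_le_char\<close>), so that \<open>\<nu>\<close> looks like a
  measure with bounded density at all scales \<open>r \<ge> \<rho>\<close>.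

  The second half transports this to smaller scales. After \<open>k\<close> steps of self-similarity, \<open>\<nu>\<close> is a mixture
  of copies of itself shrunk by \<open>a ^ k\<close>, and a ball of radius \<open>r\<close> meets only copies lying within
  \<open>r + 2 a ^ k / \<epsilon>\<close> of its centre. This gives a submultiplicativity of the concentration function
  (\<open>measure_ball_submultiplicative\<close>). With \<open>a ^ k\<close> close to \<open>\<epsilon> \<rho>\<close>, every decrease of the scale by the factor
  \<open>a ^ k\<close> gains a factor \<open>12 \<rho>\<close>, so \<open>\<nu> (B(x, r))\<close> is of order at most \<open>r powr s\<close> with
  \<open>s = ln (12 \<rho>) / ln (a ^ k)\<close>. Up to bounded terms in numerator and denominator, this is
  \<open>(c/\<epsilon>) / (c/\<epsilon> + ln (1/\<epsilon>))\<close>, that is, \<open>1 - O(\<epsilon> ln (1/\<epsilon>))\<close>: the loss \<open>ln (1/\<epsilon>)\<close> per step is the diameter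
  \<open>1/\<epsilon>\<close> of the support, and it is paid once per \<open>c/\<epsilon>\<close> units of logarithmic scale.
\<close>

section \<open>Measures on the line\<close>

text \<open>
  By the Lindelof property, the union of all null open sets is null. Nonemptiness matters for the
  Frostman exponent: over an empty support the supremum, and hence its logarithm, would be
  a meaningless default.
\<close>

lemma msupport_nonempty:
  fixes \<mu> :: "'a::second_countable_topology measure"
  assumes sets: "sets \<mu> = sets borel" and nonnull: "emeasure \<mu> (space \<mu>) \<noteq> 0"
  shows "msupport \<mu> \<noteq> {}"
proof
  assume empty: "msupport \<mu> = {}"
  define F where "F = {U. open U \<and> emeasure \<mu> U = 0}"
  have cover: "\<Union>F = UNIV"
    using empty by (fastforce simp: F_def msupport_def zero_less_iff_neq_zero)
  obtain F' where F': "F' \<subseteq> F" "countable F'" "\<Union>F' = \<Union>F"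
    using Lindelof[of F] by (auto simp: F_def)
  have "(\<Union>U\<in>F'. U) \<in> null_sets \<mu>"
    using F' by (intro null_sets_UN') (auto simp: F_def null_sets_def sets)
  then have "emeasure \<mu> UNIV = 0"
    using F' cover by auto
  moreover have "space \<mu> = UNIV"
    using sets_eq_imp_space_eq[OF sets] by simp
  ultimately show False
    using nonnull by simp
qed

text \<open>
  Taking logarithms turns the power bound into \<open>s + ln K / ln r\<close>, and \<open>ln r\<close> tends to \<open>-\<infinity>\<close>.
\<close>

lemma frostman_exponent_ge:
  fixes \<mu> :: "real measure"
  assumes "prob_space \<mu>" and sets: "sets \<mu> = sets borel" and K: "K > 0"
    and bound: "\<And>x r. 0 < r \<Longrightarrow> measure \<mu> (ball x r) \<le> K * r powr s"
  shows "frostman_exponent \<mu> \<ge> ereal s"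
proof -
  interpret prob_space \<mu> by fact
  define Q where "Q r = (SUP x\<in>msupport \<mu>. measure \<mu> (ball x r))" for r
  obtain x0 where x0: "x0 \<in> msupport \<mu>"
    using msupport_nonempty[OF sets] emeasure_space_1 by auto
  have Q_pos: "0 < Q r" if "0 < r" for r
  proof -
    have "0 < measure \<mu> (ball x0 r)"
      using x0 that by (auto simp: msupport_def emeasure_eq_measure)
    also have "\<dots> \<le> Q r"
      unfolding Q_def by (rule cSUP_upper[OF x0]) (auto intro!: bdd_aboveI[of _ 1])
    finally show ?thesis .
  qed
  have Q_le: "Q r \<le> K * r powr s" if "0 < r" for r
    unfolding Q_def using x0 bound[OF that] by (intro cSUP_least) auto
  have quotient_ge: "s + ln K / ln r \<le> ln (Q r) / ln r" if r: "0 < r" "r < 1" for r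
  proof -
    have "ln (Q r) \<le> ln (K * r powr s)"
      using Q_pos Q_le r by (intro ln_mono) auto
    also have "\<dots> = ln K + s * ln r"
      using K r by (simp add: ln_mult ln_powr)
    finally have "(ln K + s * ln r) / ln r \<le> ln (Q r) / ln r"
      using r by (intro divide_right_mono_neg) auto
    then show ?thesis
      using r by (simp add: add_divide_distrib add.commute)
  qed
  have "filterlim ln at_bot (at_right (0::real))"
    by (rule ln_at_0)
  then have "((\<lambda>r. ln K / ln r) \<longlongrightarrow> 0) (at_right (0::real))"
    by (intro tendsto_divide_0[OF tendsto_const]) (rule filterlim_mono[OF _ at_bot_le_at_infinity], auto)
  then have "((\<lambda>r. s + ln K / ln r) \<longlongrightarrow> s + 0) (at_right (0::real))"
    by (intro tendsto_intros)
  then have "ereal s = Liminf (at_right 0) (\<lambda>r. ereal (s + ln K / ln r))"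
    by (intro lim_imp_Liminf[symmetric]) (auto intro!: tendsto_eq_intros)
  also have "\<dots> \<le> Liminf (at_right 0) (\<lambda>r. ereal (ln (Q r) / ln r))"
    by (rule Liminf_mono)
       (auto simp: eventually_at_right_field intro!: exI[of _ 1] quotient_ge)
  finally show ?thesis
    by (simp add: frostman_exponent_def Q_def)
qed

lemma std_normal_interval_le:
  assumes "0 \<le> (r::real)"
  shows "measure std_normal_distribution {-r..r} \<le> r"
proof -
  have density: "std_normal_density x \<le> 1 / 2" for x
  proof -
    have "2 \<le> sqrt (2 * pi)"
      using pi_gt3 by (intro real_le_rsqrt) auto
    moreover have "exp (- x\<^sup>2 / 2) \<le> 1"
      by simp
    ultimately show ?thesis
      using frac_le[of 1 "exp (- x\<^sup>2 / 2)" 1 2] frac_le[of 1 "exp (- x\<^sup>2 / 2)" 2 "sqrt (2 * pi)"]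
      by (simp add: std_normal_density_def)
  qed
  have "emeasure std_normal_distribution {-r..r} =
      (\<integral>\<^sup>+x. ennreal (std_normal_density x) * indicator {-r..r} x \<partial>lborel)"
    by (subst emeasure_density) auto
  also have "\<dots> \<le> (\<integral>\<^sup>+x. ennreal (1 / 2) * indicator {-r..r} x \<partial>lborel)"
    by (intro nn_integral_mono mult_right_mono ennreal_leI density zero_le)
  also have "\<dots> = ennreal (1 / 2) * ennreal (2 * r)"
    using assms by (subst nn_integral_cmult_indicator) auto
  also have "\<dots> = ennreal (1 / 2 * (2 * r))"
    using assms by (intro ennreal_mult[symmetric]) auto
  finally show ?thesis
    using assms by (auto simp: measure_def intro!: enn2real_leI)
qed

text \<open>
  Fourier inversion with a Gaussian in place of the indicator of the ball. The Gaussian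
  \<open>exp (- ((y - x) / r)\<^sup>2 / 2)\<close> is the characteristic function of a standard normal variable \<open>Z\<close> at
  \<open>(y - x) / r\<close>; so, by Fubini, its integral over \<open>\<mu>\<close> is an average of \<open>char \<mu> (Z / r)\<close> against a phase.
  The frequencies \<open>\<bar>Z / r\<bar> \<le> 1\<close> have probability at most \<open>r\<close>, and the others contribute at most \<open>\<delta>\<close>.
\<close>

lemma measure_ball_le_char:
  fixes \<mu> :: "real measure"
  assumes "real_distribution \<mu>" and r: "0 < r"
    and decay: "\<And>t. 1 \<le> \<bar>t\<bar> \<Longrightarrow> norm (char \<mu> t) \<le> \<delta>"
  shows "measure \<mu> (ball x r) \<le> 2 * (r + \<delta>)"
proof -
  interpret real_distribution \<mu> by fact
  interpret N: real_distribution std_normal_distribution by (rule real_dist_normal_dist)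
  interpret P: pair_prob_space \<mu> std_normal_distribution ..
  let ?g = "\<lambda>y. exp (- ((y - x) / r)\<^sup>2 / 2) :: real"
  have \<delta>: "0 \<le> \<delta>"
    by (rule order_trans[OF norm_ge_zero decay[of 1]]) simp
  have pointwise: "indicator (ball x r) y \<le> 2 * ?g y" for y
  proof (cases "y \<in> ball x r")
    case True
    then have "((y - x) / r)\<^sup>2 \<le> 1"
      using r by (auto simp: abs_square_le_1 dist_real_def)
    then have "exp (- (1 / 2)) \<le> ?g y"
      unfolding exp_le_cancel_iff by simp
    moreover have "1 / 2 \<le> exp (- (1 / 2) :: real)"
      using exp_half_le2 by (simp add: exp_minus field_simps)
    ultimately have "1 \<le> 2 * ?g y"
      by linarith
    then show ?thesis
      using True by simp
  qed auto
  have g_int: "integrable \<mu> ?g"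
    by (rule integrable_const_bound[of _ 1]) auto
  have int: "integrable (\<mu> \<Otimes>\<^sub>M std_normal_distribution) (\<lambda>(y, z). iexp ((y - x) / r * z))"
    by (rule P.integrable_const_bound[of _ 1]) (auto simp: split_beta')
  have "complex_of_real (\<integral>y. ?g y \<partial>\<mu>) = (\<integral>y. complex_of_real (?g y) \<partial>\<mu>)"
    by simp
  also have "\<dots> = (\<integral>y. char std_normal_distribution ((y - x) / r) \<partial>\<mu>)"
    by (simp add: char_std_normal_distribution)
  also have "\<dots> = (\<integral>y. (\<integral>z. iexp ((y - x) / r * z) \<partial>std_normal_distribution) \<partial>\<mu>)"
    by (simp add: char_def)
  also have "\<dots> = (\<integral>z. (\<integral>y. iexp ((y - x) / r * z) \<partial>\<mu>) \<partial>std_normal_distribution)"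
    using P.Fubini_integral[OF int] by simp
  also have "\<dots> = (\<integral>z. iexp (- (z * x / r)) * char \<mu> (z / r) \<partial>std_normal_distribution)"
  proof (rule Bochner_Integration.integral_cong[OF refl])
    fix z
    have "(\<integral>y. iexp ((y - x) / r * z) \<partial>\<mu>) = (\<integral>y. iexp (- (z * x / r)) * iexp (z / r * y) \<partial>\<mu>)"
      by (rule Bochner_Integration.integral_cong[OF refl])
         (simp add: exp_add[symmetric] diff_divide_distrib algebra_simps)
    also have "\<dots> = iexp (- (z * x / r)) * char \<mu> (z / r)"
      unfolding char_def by (rule integral_mult_right_zero)
    finally show "(\<integral>y. iexp ((y - x) / r * z) \<partial>\<mu>) = iexp (- (z * x / r)) * char \<mu> (z / r)" .
  qed
  finally have eq: "complex_of_real (\<integral>y. ?g y \<partial>\<mu>) =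
      (\<integral>z. iexp (- (z * x / r)) * char \<mu> (z / r) \<partial>std_normal_distribution)" .
  have "\<bar>\<integral>y. ?g y \<partial>\<mu>\<bar> = norm (complex_of_real (\<integral>y. ?g y \<partial>\<mu>))"
    by simp
  also have "\<dots> \<le> (\<integral>z. norm (iexp (- (z * x / r)) * char \<mu> (z / r)) \<partial>std_normal_distribution)"
    unfolding eq by (rule integral_norm_bound)
  also have "\<dots> \<le> (\<integral>z. indicator {-r..r} z + \<delta> \<partial>std_normal_distribution)"
  proof (rule integral_mono)
    show "integrable std_normal_distribution (\<lambda>z. norm (iexp (- (z * x / r)) * char \<mu> (z / r)))"
      by (rule N.integrable_const_bound[of _ 1]) (auto simp: norm_mult cmod_char_le_1)
    show "integrable std_normal_distribution (\<lambda>z. indicator {-r..r} z + \<delta>)"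
      by (rule N.integrable_const_bound[of _ "1 + \<delta>"]) (use \<delta> in \<open>auto simp: indicator_def\<close>)
    fix z
    show "norm (iexp (- (z * x / r)) * char \<mu> (z / r)) \<le> indicator {-r..r} z + \<delta>"
    proof (cases "z \<in> {-r..r}")
      case True
      then show ?thesis
        using cmod_char_le_1[of "z / r"] \<delta> by (simp add: norm_mult)
    next
      case False
      then show ?thesis
        using decay[of "z / r"] r by (auto simp: norm_mult abs_le_iff field_simps)
    qed
  qed
  also have "\<dots> = measure std_normal_distribution {-r..r} + \<delta>"
  proof (subst Bochner_Integration.integral_add)
    show "integrable std_normal_distribution (indicat_real {-r..r})"
      by (rule N.integrable_const_bound[of _ 1]) (auto simp: indicator_def)
  qed (auto simp: N.prob_space[simplified])
  also have "\<dots> \<le> r + \<delta>"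
    using std_normal_interval_le r by simp
  finally have "(\<integral>y. ?g y \<partial>\<mu>) \<le> r + \<delta>"
    by simp
  moreover have "measure \<mu> (ball x r) = (\<integral>y. indicator (ball x r) y \<partial>\<mu>)"
    by simp
  moreover have "\<dots> \<le> (\<integral>y. 2 * ?g y \<partial>\<mu>)"
    using g_int
    by (intro integral_mono pointwise) (auto intro!: integrable_const_bound[of _ 1] simp: indicator_def)
  ultimately show ?thesis
    by simp
qed

section \<open>Self-similarity\<close>

locale bernoulli_parameters =
  fixes a p :: real
  assumes a: "0 < a" "a < 1" and p: "0 < p" "p < 1"
begin

abbreviation \<nu> :: "real measure" where
  "\<nu> \<equiv> bernoulli_convolution a p"

sublocale real_distribution \<nu>
proof -
  have "sets \<nu> = sets borel"
    by (simp add: bernoulli_convolution_def)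
  then show "real_distribution \<nu>"
    using prob_space_bernoulli_convolution
    by (simp add: real_distribution_def real_distribution_axioms_def)
qed

lemma summable_signs: "summable (\<lambda>n. (if \<omega> n then 1 else - 1) * a ^ Suc n)"
  by (rule summable_comparison_test[of _ "\<lambda>n. a ^ n * a"])
     (use a in \<open>auto intro!: exI[of _ 0] summable_mult2 summable_geometric simp: abs_mult\<close>)

lemma random_sum_bounded: "\<bar>random_sum a \<omega>\<bar> < 1 / (1 - a)"
proof -
  have sums: "(\<lambda>n. a * a ^ n) sums (a * (1 / (1 - a)))"
    using a by (intro sums_mult geometric_sums) auto
  have "\<bar>random_sum a \<omega>\<bar> \<le> (\<Sum>n. a * a ^ n)"
    unfolding random_sum_def real_norm_def[symmetric]
    by (rule norm_suminf_le) (use a sums in \<open>auto simp: abs_mult sums_iff\<close>)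
  also have "\<dots> = a * (1 / (1 - a))"
    using sums by (simp add: sums_iff)
  also have "\<dots> < 1 / (1 - a)"
    using a mult_strict_right_mono[of a 1 "1 / (1 - a)"] by simp
  finally show ?thesis .
qed

lemma random_sum_case_nat:
  "random_sum a (case_nat b \<omega>) = (if b then a else - a) + a * random_sum a \<omega>"
proof -
  let ?f = "\<lambda>n. (if (case_nat b \<omega>) n then 1 else - 1) * a ^ Suc n"
  have "random_sum a (case_nat b \<omega>) = ?f 0 + (\<Sum>n. ?f (Suc n))"
    unfolding random_sum_def using suminf_split_head[OF summable_signs[of "case_nat b \<omega>"]] by simp
  also have "(\<Sum>n. ?f (Suc n)) = (\<Sum>n. a * ((if \<omega> n then 1 else - 1) * a ^ Suc n))"
    by (intro suminf_cong) (auto simp: algebra_simps)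
  also have "\<dots> = a * random_sum a \<omega>"
    unfolding random_sum_def by (rule suminf_mult[OF summable_signs])
  finally show ?thesis
    by simp
qed

text \<open>
  The self-similarity of \<open>\<nu>\<close>, tested against bounded functions: splitting off the first sign leaves
  a scaled copy of the same random sum, independent of that sign.
\<close>

lemma integral_self_similar:
  fixes f :: "real \<Rightarrow> 'b::{banach, second_countable_topology}"
  assumes f [measurable]: "f \<in> borel_measurable borel" and bounded: "\<And>x. norm (f x) \<le> B"
  shows "(\<integral>x. f x \<partial>\<nu>) =
    p *\<^sub>R (\<integral>x. f (a + a * x) \<partial>\<nu>) + (1 - p) *\<^sub>R (\<integral>x. f (- a + a * x) \<partial>\<nu>)"
proof -
  let ?M = "measure_pmf (bernoulli_pmf p)" and ?S = "sign_space p"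
  interpret sequence_space ?M ..
  have S: "?S = S"
    by (simp add: sign_space_def)
  interpret S: prob_space ?S
    unfolding S by (rule prob_space_axioms)
  interpret P: pair_prob_space ?M ?S ..
  have [measurable]: "(\<lambda>(b, \<omega>). case_nat b \<omega>) \<in> measurable (?M \<Otimes>\<^sub>M ?S) ?S"
    unfolding S by measurable
  have "(\<integral>x. f x \<partial>\<nu>) = (\<integral>\<omega>. f (random_sum a \<omega>) \<partial>?S)"
    unfolding bernoulli_convolution_def by (rule integral_distr) measurable
  also have "\<dots> = (\<integral>\<omega>. f (random_sum a \<omega>) \<partial>distr (?M \<Otimes>\<^sub>M ?S) ?S (\<lambda>(b, \<omega>). case_nat b \<omega>))"
    using PiM_iter by (simp add: S)
  also have "\<dots> = (\<integral>(b, \<omega>). f (random_sum a (case_nat b \<omega>)) \<partial>(?M \<Otimes>\<^sub>M ?S))"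
    by (subst integral_distr) (auto simp: split_beta')
  also have "\<dots> = (\<integral>b. (\<integral>\<omega>. f (random_sum a (case_nat b \<omega>)) \<partial>?S) \<partial>?M)"
    by (rule P.integral_fst[symmetric], rule P.integrable_const_bound[of _ B])
       (auto simp: bounded split_beta')
  also have "\<dots> = p *\<^sub>R (\<integral>\<omega>. f (random_sum a (case_nat True \<omega>)) \<partial>?S)
      + (1 - p) *\<^sub>R (\<integral>\<omega>. f (random_sum a (case_nat False \<omega>)) \<partial>?S)"
    using p by (subst integral_measure_pmf[of UNIV]) (auto simp: UNIV_bool)
  also have "\<dots> = p *\<^sub>R (\<integral>x. f (a + a * x) \<partial>\<nu>) + (1 - p) *\<^sub>R (\<integral>x. f (- a + a * x) \<partial>\<nu>)"
    unfolding bernoulli_convolution_def random_sum_case_nat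
    by (subst (1 2) integral_distr) auto
  finally show ?thesis .
qed

lemma measure_ball_self_similar:
  "measure \<nu> (ball x r) =
    p * measure \<nu> (ball (x / a - 1) (r / a)) + (1 - p) * measure \<nu> (ball (x / a + 1) (r / a))"
proof -
  have plus: "indicator (ball x r) (a + a * y) = (indicator (ball (x / a - 1) (r / a)) y :: real)" for y
  proof -
    have "x - (a + a * y) = a * (x / a - 1 - y)"
      using a by (simp add: field_simps)
    then have "dist x (a + a * y) = a * dist (x / a - 1) y"
      using a by (simp add: dist_real_def abs_mult)
    then show ?thesis
      using a by (simp add: indicator_def field_simps)
  qed
  have minus: "indicator (ball x r) (- a + a * y) = (indicator (ball (x / a + 1) (r / a)) y :: real)" for y
  proof -
    have "x - (- a + a * y) = a * (x / a + 1 - y)"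
      using a by (simp add: field_simps)
    then have "dist x (- a + a * y) = a * dist (x / a + 1) y"
      using a by (simp add: dist_real_def abs_mult)
    then show ?thesis
      using a by (simp add: indicator_def field_simps)
  qed
  have "indicat_real (ball x r) \<in> borel_measurable borel"
    by (intro borel_measurable_indicator) auto
  then show ?thesis
    using integral_self_similar[of "indicat_real (ball x r)" 1, unfolded plus minus]
    by (simp add: indicator_le_1)
qed

lemma char_self_similar:
  "char \<nu> t = (complex_of_real p * iexp (t * a) + complex_of_real (1 - p) * iexp (- (t * a))) * char \<nu> (t * a)"
proof -
  have split: "(\<integral>x. iexp (t * (c + a * x)) \<partial>\<nu>) = iexp (t * c) * char \<nu> (t * a)" for c
  proof -
    have "(\<integral>x. iexp (t * (c + a * x)) \<partial>\<nu>) = (\<integral>x. iexp (t * c) * iexp (t * a * x) \<partial>\<nu>)"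
      by (rule Bochner_Integration.integral_cong[OF refl])
         (simp add: exp_add[symmetric] algebra_simps)
    then show ?thesis
      unfolding char_def by (simp only: integral_mult_right_zero)
  qed
  have "char \<nu> t = p *\<^sub>R (\<integral>x. iexp (t * (a + a * x)) \<partial>\<nu>)
      + (1 - p) *\<^sub>R (\<integral>x. iexp (t * (- a + a * x)) \<partial>\<nu>)"
    unfolding char_def by (rule integral_self_similar[of _ 1]) auto
  then show ?thesis
    unfolding split by (simp add: scaleR_conv_of_real algebra_simps)
qed

section \<open>Decay of the characteristic function\<close>

text \<open>
  The squared modulus is \<open>1 - 4 p (1 - p) sin\<^sup>2 \<theta>\<close>.
\<close>

lemma norm_two_point_char_le:
  "norm (complex_of_real p * iexp \<theta> + complex_of_real (1 - p) * iexp (- \<theta>))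
    \<le> exp (- (2 * p * (1 - p) * (sin \<theta>)\<^sup>2))"
proof (rule power2_le_imp_le)
  let ?z = "complex_of_real p * iexp \<theta> + complex_of_real (1 - p) * iexp (- \<theta>)"
  have "?z = Complex (cos \<theta>) ((2 * p - 1) * sin \<theta>)"
    by (simp add: complex_eq_iff Re_exp Im_exp algebra_simps)
  then have "(norm ?z)\<^sup>2 = (cos \<theta>)\<^sup>2 + ((2 * p - 1) * sin \<theta>)\<^sup>2"
    by (simp add: cmod_def)
  also have "\<dots> = 1 + - (4 * p * (1 - p) * (sin \<theta>)\<^sup>2)"
    unfolding cos_squared_eq by (simp add: power2_eq_square algebra_simps)
  also have "\<dots> \<le> exp (- (4 * p * (1 - p) * (sin \<theta>)\<^sup>2))"
    by (rule exp_ge_add_one_self)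
  also have "\<dots> = (exp (- (2 * p * (1 - p) * (sin \<theta>)\<^sup>2)))\<^sup>2"
    by (simp add: power2_eq_square exp_add[symmetric])
  finally show "(norm ?z)\<^sup>2 \<le> (exp (- (2 * p * (1 - p) * (sin \<theta>)\<^sup>2)))\<^sup>2" .
qed simp

lemma norm_char_step:
  "norm (char \<nu> t) \<le> exp (- (2 * p * (1 - p) * (sin (t * a))\<^sup>2)) * norm (char \<nu> (t * a))"
  using norm_two_point_char_le[of "t * a"]
  by (subst char_self_similar) (auto simp: norm_mult intro!: mult_right_mono)

lemma norm_char_le_rescaled: "norm (char \<nu> t) \<le> norm (char \<nu> (t * a ^ n))"
proof (induction n)
  case (Suc n)
  have "0 \<le> 2 * p * (1 - p) * (sin (t * a ^ n * a))\<^sup>2"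
    using p by simp
  then have "exp (- (2 * p * (1 - p) * (sin (t * a ^ n * a))\<^sup>2)) \<le> 1"
    by simp
  then have "norm (char \<nu> (t * a ^ n)) \<le> 1 * norm (char \<nu> (t * a ^ n * a))"
    using norm_char_step[of "t * a ^ n"]
    by (meson order_trans mult_right_mono norm_ge_zero)
  with Suc show ?case
    by (simp add: ac_simps)
qed simp

lemma sin_squared_ge:
  fixes x :: real
  assumes "1 / 2 \<le> \<bar>x\<bar>" "\<bar>x\<bar> \<le> 1"
  shows "1 / 16 \<le> (sin x)\<^sup>2"
proof -
  define y where "y = \<bar>x\<bar>"
  have y: "1 / 2 \<le> y" "y \<le> 1"
    using assms by (auto simp: y_def)
  have "\<bar>sin y - (\<Sum>m<3. sin_coeff m * y ^ m)\<bar> \<le> inverse (fact 3) * \<bar>y\<bar> ^ 3"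
    by (rule Maclaurin_sin_bound)
  then have "\<bar>sin y - y\<bar> \<le> y ^ 3 / 6"
    using y by (simp add: numeral_3_eq_3 sin_coeff_def fact_numeral)
  moreover have "y ^ 3 \<le> y"
    using y power_decreasing[of 1 3 y] by simp
  ultimately have "1 / 4 \<le> sin y"
    using y by linarith
  then have "(1 / 4)\<^sup>2 \<le> (sin y)\<^sup>2"
    by (intro power_mono) auto
  then show ?thesis
    by (cases "0 \<le> x") (auto simp: y_def power2_eq_square)
qed

text \<open>
  As long as the angles stay in \<open>[1/2, 1]\<close>, each of the \<open>m\<close> factors has \<open>sin\<^sup>2 \<ge> 1/16\<close>.
\<close>

lemma norm_char_le_window:
  assumes "1 / 2 \<le> \<bar>t\<bar> * a ^ m" "\<bar>t\<bar> \<le> 1"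
  shows "norm (char \<nu> t) \<le> exp (- (real m * (p * (1 - p) / 8)))"
  using assms
proof (induction m arbitrary: t)
  case 0
  then show ?case
    by (simp add: cmod_char_le_1)
next
  case (Suc m)
  have upper: "\<bar>t * a\<bar> \<le> 1"
    using Suc.prems a by (simp add: abs_mult mult_le_one)
  have window: "1 / 2 \<le> \<bar>t * a\<bar> * a ^ m"
    using Suc.prems a by (simp add: abs_mult ac_simps)
  also have "\<dots> \<le> \<bar>t * a\<bar> * 1"
    using a by (intro mult_left_mono power_le_one) auto
  finally have "1 / 16 \<le> (sin (t * a))\<^sup>2"
    using upper by (intro sin_squared_ge) auto
  then have "2 * p * (1 - p) * (1 / 16) \<le> 2 * p * (1 - p) * (sin (t * a))\<^sup>2"
    using p by (intro mult_left_mono) auto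
  then have "exp (- (2 * p * (1 - p) * (sin (t * a))\<^sup>2)) \<le> exp (- (p * (1 - p) / 8))"
    by simp
  then have "norm (char \<nu> t) \<le> exp (- (p * (1 - p) / 8)) * exp (- (real m * (p * (1 - p) / 8)))"
    using Suc.IH[OF window upper] norm_char_step[of t]
    by (meson order_trans mult_mono norm_ge_zero exp_ge_zero)
  also have "\<dots> = exp (- (real (Suc m) * (p * (1 - p) / 8)))"
    by (simp only: exp_add[symmetric] of_nat_Suc distrib_right) simp
  finally show ?case .
qed

text \<open>
  The powers of \<open>a\<close> form a geometric scale of ratio \<open>a\<close>, so the first one to reach \<open>y\<close> overshoots
  by less than a factor \<open>a\<close>.
\<close>

lemma power_crossing:
  fixes y :: real
  assumes "0 < y" "y < 1"
  obtains k where "a ^ k \<le> y" "a * y < a ^ k"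
proof -
  obtain n where n: "a ^ n < y"
    using real_arch_pow_inv[OF assms(1) a(2)] by blast
  define k where "k = (LEAST k. a ^ k \<le> y)"
  have k: "a ^ k \<le> y"
    unfolding k_def by (rule LeastI[of _ n]) (use n in simp)
  then obtain j where j: "k = Suc j"
    using assms by (cases k) auto
  have "\<not> a ^ j \<le> y"
    using not_less_Least[of j "\<lambda>k. a ^ k \<le> y"] j k_def by auto
  then have "a * y < a ^ k"
    using a j by simp
  with k that show ?thesis
    by blast
qed

text \<open>
  Rescaling by a suitable \<open>a ^ k\<close> brings the frequency into \<open>[a, 1]\<close>. From there the next \<open>m\<close> angles
  stay above \<open>1/2\<close> whenever \<open>(m + 1) (1 - a) \<le> 1/2\<close>, by Bernoulli's inequality; so one can take
  \<open>m \<ge> 1 / (4 (1 - a))\<close>.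
\<close>

lemma norm_char_decay:
  assumes near: "7 / 8 \<le> a" and t: "1 \<le> \<bar>t\<bar>"
  shows "norm (char \<nu> t) \<le> exp (- (p * (1 - p) / 32 / (1 - a)))"
proof -
  define m where "m = nat \<lfloor>1 / (2 * (1 - a))\<rfloor> - 1"
  have floor: "4 \<le> 1 / (2 * (1 - a))"
    using near a by (simp add: field_simps)
  have m_eq: "real m = of_int \<lfloor>1 / (2 * (1 - a))\<rfloor> - 1"
  proof -
    have "4 \<le> \<lfloor>1 / (2 * (1 - a))\<rfloor>"
      using floor by (simp add: le_floor_iff)
    then show ?thesis
      unfolding m_def by linarith
  qed
  have m_ge: "1 / (4 * (1 - a)) \<le> real m"
  proof -
    define v where "v = 1 / (2 * (1 - a))"
    have "1 / (4 * (1 - a)) = v / 2"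
      using a by (simp add: v_def field_simps)
    moreover have "v / 2 \<le> of_int \<lfloor>v\<rfloor> - 1"
      using floor unfolding v_def[symmetric] by linarith
    ultimately show ?thesis
      by (simp only: m_eq v_def)
  qed
  have "real (Suc m) \<le> 1 / (2 * (1 - a))"
    unfolding m_eq of_nat_Suc by linarith
  then have "real (Suc m) * (1 - a) \<le> 1 / 2"
    using a by (simp add: field_simps)
  moreover have "1 + real (Suc m) * (a - 1) \<le> (1 + (a - 1)) ^ Suc m"
    using a by (intro Bernoulli_inequality) auto
  ultimately have half: "1 / 2 \<le> a ^ Suc m"
    by (simp add: algebra_simps)
  obtain k where k: "\<bar>t\<bar> * a ^ k \<le> 1" "a \<le> \<bar>t\<bar> * a ^ k"
  proof (cases "\<bar>t\<bar> = 1")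
    case True
    then show ?thesis
      using that[of 0] a by simp
  next
    case False
    then have "0 < 1 / \<bar>t\<bar>" "1 / \<bar>t\<bar> < 1"
      using t by auto
    then obtain k where "a ^ k \<le> 1 / \<bar>t\<bar>" "a * (1 / \<bar>t\<bar>) < a ^ k"
      by (rule power_crossing)
    then show ?thesis
      using that[of k] t by (auto simp: field_simps)
  qed
  have "1 / 2 \<le> a * a ^ m"
    using half by simp
  also have "\<dots> \<le> \<bar>t * a ^ k\<bar> * a ^ m"
    using a k by (intro mult_right_mono) (auto simp: abs_mult)
  finally have "norm (char \<nu> (t * a ^ k)) \<le> exp (- (real m * (p * (1 - p) / 8)))"
    using k a by (intro norm_char_le_window) (auto simp: abs_mult)
  also have "\<dots> \<le> exp (- (1 / (4 * (1 - a)) * (p * (1 - p) / 8)))"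
    unfolding exp_le_cancel_iff neg_le_iff_le using p by (intro mult_right_mono m_ge) auto
  finally show ?thesis
    using norm_char_le_rescaled[of t k] by (simp add: field_simps)
qed

section \<open>Concentration at small scales\<close>

text \<open>
  Iterating the self-similarity \<open>k\<close> times writes the measure of the small ball as an average of measures of balls of
  radius \<open>r / a ^ k\<close>, each at most \<open>M\<close>; the terms that do not vanish belong to copies of \<open>\<nu>\<close> that lie entirely in
  the larger ball. In the induction on \<open>k\<close> both sides obey the same averaging identity, so only \<open>k = 0\<close>
  uses the support of \<open>\<nu>\<close>: a ball of radius \<open>r\<close> either misses \<open>(-L, L)\<close>, where \<open>L = 1 / (1 - a)\<close>, or
  its enlargement by \<open>2 L\<close> contains this interval.
\<close>

lemma measure_ball_submultiplicative:
  assumes "\<And>y. measure \<nu> (ball y (r / a ^ k)) \<le> M"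
  shows "measure \<nu> (ball x r) \<le> M * measure \<nu> (ball x (r + 2 * a ^ k / (1 - a)))"
  using assms
proof (induction k arbitrary: x r)
  case 0
  let ?L = "1 / (1 - a)"
  have L: "measure \<nu> A = measure (sign_space p) {\<omega> \<in> space (sign_space p). random_sum a \<omega> \<in> A}"
    if "A \<in> sets borel" for A
    unfolding bernoulli_convolution_def using that
    by (subst measure_distr) (auto intro!: arg_cong[of _ _ "measure _"])
  have M: "0 \<le> M"
    using 0[of 0] measure_nonneg order_trans by blast
  show ?case
  proof (cases "\<bar>x\<bar> < r + ?L")
    case True
    have "measure \<nu> (ball x (r + 2 * ?L)) = measure (sign_space p) (space (sign_space p))"
    proof -
      have "random_sum a \<omega> \<in> ball x (r + 2 * ?L)" for \<omega>
        using True random_sum_bounded[of \<omega>] by (auto simp: dist_real_def)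
      then show ?thesis
        by (subst L) auto
    qed
    also have "\<dots> = 1"
      unfolding sign_space_def
      by (intro prob_space.prob_space prob_space_PiM prob_space_measure_pmf)
    finally show ?thesis
      using 0[of x] by simp
  next
    case False
    have "random_sum a \<omega> \<notin> ball x r" for \<omega>
      using False random_sum_bounded[of \<omega>] by (auto simp: dist_real_def)
    then have "measure \<nu> (ball x r) = 0"
      by (subst L) auto
    then show ?thesis
      using M by simp
  qed
next
  case (Suc k)
  let ?R = "r / a + 2 * a ^ k / (1 - a)"
  have eq: "(r + 2 * a ^ Suc k / (1 - a)) / a = ?R"
    using a by (simp add: field_simps)
  have IH: "measure \<nu> (ball y (r / a)) \<le> M * measure \<nu> (ball y ?R)" for y
    using Suc.prems by (intro Suc.IH) (simp add: field_simps)
  have "measure \<nu> (ball x r) =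
      p * measure \<nu> (ball (x / a - 1) (r / a)) + (1 - p) * measure \<nu> (ball (x / a + 1) (r / a))"
    by (rule measure_ball_self_similar)
  also have "\<dots> \<le> p * (M * measure \<nu> (ball (x / a - 1) ?R))
      + (1 - p) * (M * measure \<nu> (ball (x / a + 1) ?R))"
    using p by (intro add_mono mult_left_mono IH) auto
  also have "\<dots> = M * measure \<nu> (ball x (r + 2 * a ^ Suc k / (1 - a)))"
    by (subst measure_ball_self_similar[of x "r + 2 * a ^ Suc k / (1 - a)"], subst (1 2) eq) (simp add: algebra_simps)
  finally show ?case .
qed

text \<open>
  The exponent \<open>s\<close> is chosen so that \<open>(a ^ k) powr s = 12 * \<rho>\<close>: passing from the scale \<open>r / a ^ k\<close> to \<open>r\<close>
  multiplies the power law by exactly the factor gained from submultiplicativity. That factor is the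
  measure of a ball of radius at most \<open>3 * \<rho>\<close>. At scales above \<open>\<rho>\<close> the power law is at least \<open>1\<close>.
\<close>

lemma measure_ball_power_law:
  assumes \<rho>: "0 < \<rho>" and \<rho>_le: "12 * \<rho> \<le> 1"
    and base: "\<And>x r. \<rho> \<le> r \<Longrightarrow> measure \<nu> (ball x r) \<le> 4 * r"
    and \<theta>: "a ^ k / (1 - a) \<le> \<rho>" and s: "s = ln (12 * \<rho>) / ln (a ^ k)" and r: "0 < r"
  shows "measure \<nu> (ball x r) \<le> (r / \<rho>) powr s"
proof -
  have \<theta>_pos: "0 < a ^ k"
    using a by simp
  have "a ^ k \<le> \<rho> * (1 - a)"
    using \<theta> a by (simp add: field_simps)
  also have "\<dots> \<le> \<rho>"
    using \<rho> a by (simp add: mult_le_cancel_left1)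
  finally have \<theta>_lt: "a ^ k < 1"
    using \<rho> \<rho>_le by simp
  have s_nonneg: "0 \<le> s"
    unfolding s using \<rho> \<rho>_le \<theta>_pos \<theta>_lt by (intro divide_nonpos_nonpos) auto
  have \<theta>_powr: "(a ^ k) powr s = 12 * \<rho>"
    using s \<rho> \<theta>_pos \<theta>_lt unfolding powr_def by (simp del: ln_powr power_eq_0_iff add: less_imp_neq)
  have claim: "measure \<nu> (ball x r) \<le> (r / \<rho>) powr s" if "\<rho> * (a ^ k) ^ j \<le> r" for j x r
    using that
  proof (induction j arbitrary: x r)
    case 0
    then have "1 \<le> r / \<rho>"
      using \<rho> by (simp add: field_simps)
    then have "1 \<le> (r / \<rho>) powr s"
      using s_nonneg by (rule ge_one_powr_ge_zero)
    then show ?case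
      using prob_le_1 order_trans by blast
  next
    case (Suc j)
    show ?case
    proof (cases "\<rho> \<le> r")
      case True
      then have "1 \<le> (r / \<rho>) powr s"
        using \<rho> s_nonneg by (intro ge_one_powr_ge_zero) (auto simp: field_simps)
      then show ?thesis
        using prob_le_1 order_trans by blast
    next
      case False
      have "0 < \<rho> * (a ^ k) ^ Suc j"
        using \<rho> \<theta>_pos by simp
      then have r: "0 < r"
        using Suc.prems by linarith
      have "\<rho> * (a ^ k) ^ j \<le> r / a ^ k"
        using Suc.prems \<theta>_pos by (simp add: field_simps)
      then have "measure \<nu> (ball x r) \<le> (r / a ^ k / \<rho>) powr s * measure \<nu> (ball x (r + 2 * a ^ k / (1 - a)))"
        by (intro measure_ball_submultiplicative Suc.IH)
      also have "\<dots> \<le> (r / a ^ k / \<rho>) powr s * (12 * \<rho>)"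
      proof (intro mult_left_mono)
        have "measure \<nu> (ball x (r + 2 * a ^ k / (1 - a))) \<le> measure \<nu> (ball x (3 * \<rho>))"
          using False \<theta> by (intro finite_measure_mono subset_ball) auto
        also have "\<dots> \<le> 12 * \<rho>"
          using base[of "3 * \<rho>" x] \<rho> by simp
        finally show "measure \<nu> (ball x (r + 2 * a ^ k / (1 - a))) \<le> 12 * \<rho>" .
      qed simp
      also have "\<dots> = (r / \<rho>) powr s"
      proof -
        have "(r / \<rho>) powr s = (r / a ^ k / \<rho> * a ^ k) powr s"
          using a by simp
        also have "\<dots> = (r / a ^ k / \<rho>) powr s * (a ^ k) powr s"
          by (rule powr_mult)
        finally show ?thesis
          using \<theta>_powr by simp
      qed
      finally show ?thesis .
    qed
  qed
  obtain j where "(a ^ k) ^ j < r / \<rho>"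
    using real_arch_pow_inv[of "r / \<rho>" "a ^ k"] r \<rho> \<theta>_lt by auto
  then have "\<rho> * (a ^ k) ^ j \<le> r"
    using \<rho> by (simp add: field_simps)
  then show ?thesis
    by (rule claim)
qed

text \<open>
  The choice \<open>a ^ k \<approx> \<epsilon> * \<rho>\<close> is the coarsest for which the shrunk copies of \<open>\<nu>\<close> have size about \<open>\<rho>\<close>,
  the smallest scale that the Fourier bound controls. The hypothesis on \<open>ln 12\<close> says that \<open>12 * \<rho> \<le> 1\<close>,
  so that \<open>s \<ge> 0\<close>.
\<close>

lemma frostman_exponent_bernoulli_convolution_ge:
  assumes near: "23 / 24 \<le> a" and c: "0 < c" "c \<le> p * (1 - p) / 32"
    and small: "ln 12 \<le> c / (1 - a)"
  shows "frostman_exponent \<nu> \<ge> ereal (1 - 2 / c * (1 - a) * ln (1 / (1 - a)))"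
proof -
  define \<epsilon> where "\<epsilon> = 1 - a"
  have \<epsilon>: "0 < \<epsilon>" "24 * \<epsilon> \<le> 1"
    using near a by (auto simp: \<epsilon>_def)
  define \<rho> where "\<rho> = exp (- (c / \<epsilon>))"
  have \<rho>: "0 < \<rho>"
    by (simp add: \<rho>_def)
  have ln_\<rho>: "ln \<rho> = - (c / \<epsilon>)"
    by (simp add: \<rho>_def)
  have "ln (12 * \<rho>) \<le> 0"
    using small \<rho> by (simp add: ln_mult ln_\<rho> \<epsilon>_def)
  then have \<rho>_le: "12 * \<rho> \<le> 1"
    using \<rho> by simp
  have decay: "norm (char \<nu> t) \<le> \<rho>" if "1 \<le> \<bar>t\<bar>" for t
  proof -
    have "norm (char \<nu> t) \<le> exp (- (p * (1 - p) / 32 / \<epsilon>))"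
      unfolding \<epsilon>_def using near that by (intro norm_char_decay) auto
    also have "\<dots> \<le> \<rho>"
      unfolding \<rho>_def exp_le_cancel_iff neg_le_iff_le using c \<epsilon> by (intro divide_right_mono) auto
    finally show ?thesis .
  qed
  have base: "measure \<nu> (ball x r) \<le> 4 * r" if "\<rho> \<le> r" for x r
  proof -
    have "measure \<nu> (ball x r) \<le> 2 * (r + \<rho>)"
      using that \<rho> decay by (intro measure_ball_le_char real_distribution_axioms) auto
    then show ?thesis
      using that by simp
  qed
  have "0 < \<epsilon> * \<rho>" "\<epsilon> * \<rho> < 1"
    using \<epsilon> \<rho> \<rho>_le mult_strict_mono[of \<epsilon> 1 \<rho> 1] by auto
  then obtain k where k: "a ^ k \<le> \<epsilon> * \<rho>" "a * (\<epsilon> * \<rho>) < a ^ k"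
    by (rule power_crossing)
  define s where "s = ln (12 * \<rho>) / ln (a ^ k)"
  have "frostman_exponent \<nu> \<ge> ereal s"
  proof (rule frostman_exponent_ge[where K = "\<rho> powr (- s)"])
    fix x r :: real
    assume r: "0 < r"
    have "a ^ k / (1 - a) \<le> \<rho>"
      using k \<epsilon> by (simp add: \<epsilon>_def[symmetric] field_simps)
    then have "measure \<nu> (ball x r) \<le> (r / \<rho>) powr s"
      by (intro measure_ball_power_law[OF \<rho> \<rho>_le base _ s_def r])
    then show "measure \<nu> (ball x r) \<le> \<rho> powr (- s) * r powr s"
      using r \<rho> by (simp add: powr_divide powr_minus field_simps)
  qed (use \<rho> in \<open>auto intro: prob_space_axioms\<close>)
  moreover have "1 - 2 / c * \<epsilon> * ln (1 / \<epsilon>) \<le> s"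
  proof -
    let ?l = "ln (1 / \<epsilon>)"
    \<comment> \<open>The bounded errors \<open>ln 12\<close> (from the factor \<open>12\<close>) and \<open>ln 2\<close> (from \<open>a \<ge> 1/2\<close>, the overshoot
      in the choice of \<open>k\<close>) together are at most one further \<open>ln (1 / \<epsilon>)\<close>; hence the \<open>2\<close> in \<open>2 / c\<close>.\<close>
    have ln_24: "ln 24 \<le> ?l"
      using \<epsilon> by (intro ln_mono) (auto simp: field_simps)
    have l_pos: "0 < ?l"
      using \<epsilon> by (intro ln_gt_zero) (auto simp: field_simps)
    have ln_12: "ln 12 + ln 2 = ln (24 :: real)"
      using ln_mult[of 12 "2::real"] by simp
    have "ln (a * (\<epsilon> * \<rho>)) \<le> ln (a ^ k)"
      using k a \<epsilon> \<rho> by (intro ln_mono) auto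
    moreover have "ln (a * (\<epsilon> * \<rho>)) = ln a + (- ?l - c / \<epsilon>)"
      using a \<epsilon> \<rho> by (simp add: ln_mult ln_div ln_\<rho>)
    moreover have "- ln 2 \<le> ln a"
    proof -
      have "ln (1 / 2) \<le> ln a"
        using near by (intro ln_mono) auto
      then show ?thesis
        by (simp add: ln_div)
    qed
    ultimately have upper: "- ln (a ^ k) \<le> c / \<epsilon> + ?l + ln 2"
      by linarith
    have "ln (a ^ k) \<le> ln (\<epsilon> * \<rho>)"
      using k a by (intro ln_mono) auto
    also have "\<dots> = - ?l - c / \<epsilon>"
      using \<epsilon> \<rho> by (simp add: ln_mult ln_div ln_\<rho>)
    finally have lower: "c / \<epsilon> \<le> - ln (a ^ k)"
      using l_pos by linarith
    define T where "T = - ln (a ^ k)"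
    have c_pos: "0 < c / \<epsilon>"
      using c \<epsilon> by simp
    have T: "0 < T" "c / \<epsilon> \<le> T" "T \<le> c / \<epsilon> + ?l + ln 2"
      using lower upper c_pos by (auto simp: T_def)
    have "s = - ln (12 * \<rho>) / T"
      by (simp add: s_def T_def)
    then have "s = (c / \<epsilon> - ln 12) / T"
      using \<rho> by (simp add: ln_mult ln_\<rho>)
    moreover have "T - 2 * ?l \<le> c / \<epsilon> - ln 12"
      using T ln_24 ln_12 by linarith
    ultimately have "(T - 2 * ?l) / T \<le> s"
      using T by (simp add: divide_right_mono)
    moreover have "(T - 2 * ?l) / T = 1 - 2 * ?l / T"
      using T by (simp add: field_simps)
    moreover have "2 * ?l / T \<le> 2 * ?l / (c / \<epsilon>)"
      using T c_pos l_pos by (intro divide_left_mono mult_pos_pos) auto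
    moreover have "2 * ?l / (c / \<epsilon>) = 2 / c * \<epsilon> * ?l"
      by simp
    ultimately show ?thesis
      by linarith
  qed
  ultimately show ?thesis
    unfolding \<epsilon>_def using order_trans ereal_less_eq(3) by blast
qed

end

theorem theorem1p2:
  fixes p0 :: real
  assumes "0 < p0" and "p0 < 1 / 2"
  shows "\<exists>C a0 :: real. C > 0 \<and> 0 < a0 \<and> a0 < 1 \<and>
    (\<forall>a. a0 < a \<and> a < 1 \<longrightarrow>
      (INF p\<in>{p0..1 - p0}. frostman_exponent (bernoulli_convolution a p))
        \<ge> ereal (1 - C * (1 - a) * ln (1 / (1 - a))))"
proof -
  \<comment> \<open>On \<open>[p0, 1 - p0]\<close> one has \<open>p * (1 - p) \<ge> p0 * (1 - p0) \<ge> p0 / 2\<close>.\<close>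
  define c where "c = p0 / 64"
  define a0 where "a0 = max (23 / 24) (1 - c / ln 12)"
  have c: "0 < c"
    using assms by (simp add: c_def)
  have ln_12: "0 < ln (12 :: real)"
    by simp
  have "frostman_exponent (bernoulli_convolution a p) \<ge> ereal (1 - 2 / c * (1 - a) * ln (1 / (1 - a)))"
    if near: "a0 < a" "a < 1" and range: "p \<in> {p0..1 - p0}" for a p
  proof -
    interpret bernoulli_parameters a p
      by standard (use near range assms in \<open>auto simp: a0_def\<close>)
    have "c \<le> p * (1 - p) / 32"
    proof -
      have "0 \<le> (p - p0) * (1 - p0 - p)"
        using range by (intro mult_nonneg_nonneg) auto
      then have "p0 * (1 - p0) \<le> p * (1 - p)"
        by (simp add: algebra_simps)
      moreover have "p0 * (1 / 2) \<le> p0 * (1 - p0)"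
        using assms by (intro mult_left_mono) auto
      ultimately show ?thesis
        by (simp add: c_def)
    qed
    moreover have "ln 12 \<le> c / (1 - a)"
    proof -
      have "1 - a \<le> c / ln 12"
        using near by (simp add: a0_def)
      then show ?thesis
        using a ln_12 by (simp add: field_simps)
    qed
    ultimately show ?thesis
      using near c by (intro frostman_exponent_bernoulli_convolution_ge) (auto simp: a0_def)
  qed
  moreover have "0 < a0" "a0 < 1" "0 < 2 / c"
    using c ln_12 by (auto simp: a0_def)
  ultimately show ?thesis
    by (intro exI[of _ "2 / c"] exI[of _ a0]) (auto intro!: INF_greatest)
qed

end
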